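(* $\mathcal{L}(BFEL)=\mathcal{L}(E0L)$.
   Context: An $E0L$ system is $G=(\Sigma,h,\omega,\Delta)$ with $\Sigma$ a finite alphabet, $h$ a finite substitution on $\Sigma$ (a finite set of productions $a\rightarrow u$), $\omega\in\Sigma^*$, $\Delta\subseteq\Sigma$; $L(G)=\bigcup_{i\ge0}h^i(\omega)\cap\Delta^*$, and $\mathcal{L}(E0L)$ is the class of such languages. A fuzzy $0L$ system is $FG=(\Sigma,\widetilde{h},\omega,J,f)$ where each production $a\rightarrow u$ of the finite substitution $h$ has a label $r\in J$ and a grade $f(r)\in[0,1]$. For $a\in\Sigma$, $R_a$ is the set of labels of productions with left-hand side $a$, and for $r\in R_a$, $\mu(r)=f(r)/\sum_{r_i\in R_a}f(r_i)$. For $w=a_1\cdots a_m\in\Sigma^*$, $A_w=\{\pi_1\cdots\pi_m\in J^*\mid \pi_i\in R_{a_i},\ 1\le i\le m\}$, with $\mu$ extended multiplicatively to label strings, $\mu(\pi\alpha)=\mu(\pi)\mu(\alpha)$. The fuzzy entropy is $E_f(\Lambda)=0$ and $E_f(w)=-\sum_{\alpha\in A_w}\mu(\alpha)\log_2\mu(\alpha)$. For $c\ge0$, $L(FG,E_f\le c)=\{w\in\bigcup_{i\ge0}h^i(\omega)\mid E_f(w)\le c\}$, and $\mathcal{L}(BFEL)$ is the class of all such bounded fuzzy entropy languages over all fuzzy $0L$ systems $FG$ and constants $c\ge0$. *)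

theory Defs
  imports Complex_Main "HOL-Library.Infinite_Typeclass"
begin

text \<open>Alphabets are finite sets of symbols drawn from the type \<open>'a\<close>. When comparing classes
  of languages \<open>'a\<close> should be infinite, so that auxiliary symbols never run out.\<close>

definition is_finite_subst :: "'a set \<Rightarrow> ('a \<Rightarrow> 'a list set) \<Rightarrow> bool" where
  "is_finite_subst \<Sigma> h \<longleftrightarrow> (\<forall>a\<in>\<Sigma>. finite (h a) \<and> h a \<noteq> {} \<and> h a \<subseteq> lists \<Sigma>)"

definition subst_word :: "('a \<Rightarrow> 'a list set) \<Rightarrow> 'a list \<Rightarrow> 'a list set" where
  "subst_word h w = {concat us | us. list_all2 (\<lambda>u a. u \<in> h a) us w}"

definition subst_lang :: "('a \<Rightarrow> 'a list set) \<Rightarrow> 'a list set \<Rightarrow> 'a list set" where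
  "subst_lang h L = (\<Union>w\<in>L. subst_word h w)"

definition generated :: "('a \<Rightarrow> 'a list set) \<Rightarrow> 'a list \<Rightarrow> 'a list set" where
  "generated h \<omega> = (\<Union>i. (subst_lang h ^^ i) {\<omega>})"

record 'a E0L =
  alphabet :: "'a set"
  subst :: "'a \<Rightarrow> 'a list set"
  axiom_word :: "'a list"
  terminals :: "'a set"

definition is_E0L :: "'a E0L \<Rightarrow> bool" where
  "is_E0L G \<longleftrightarrow>
     finite (alphabet G) \<and> is_finite_subst (alphabet G) (subst G) \<and>
     axiom_word G \<in> lists (alphabet G) \<and> terminals G \<subseteq> alphabet G"

definition E0L_lang :: "'a E0L \<Rightarrow> 'a list set" where
  "E0L_lang G = generated (subst G) (axiom_word G) \<inter> lists (terminals G)"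

definition class_E0L :: "'a list set set" where
  "class_E0L = {E0L_lang G | G. is_E0L G}"

text \<open>Labels are natural numbers; this is no restriction, as every fuzzy 0L system has
  only finitely many of them. The field \<open>production\<close> sends a label to the production
  \<open>(a, u)\<close> carrying it.\<close>

record 'a fuzzy_0L =
  falphabet :: "'a set"
  fsubst :: "'a \<Rightarrow> 'a list set"
  faxiom :: "'a list"
  labels :: "nat set"
  production :: "nat \<Rightarrow> 'a \<times> 'a list"
  grade :: "nat \<Rightarrow> real"

definition labels_of :: "'a fuzzy_0L \<Rightarrow> 'a \<Rightarrow> nat set" where
  "labels_of FG a = {r \<in> labels FG. fst (production FG r) = a}"

text \<open>The last condition is what makes the quotient \<open>\<mu>(r)\<close> below meaningful: its
  denominator must not vanish. Individual grades may be zero.\<close>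

definition is_fuzzy_0L :: "'a fuzzy_0L \<Rightarrow> bool" where
  "is_fuzzy_0L FG \<longleftrightarrow>
     finite (falphabet FG) \<and> is_finite_subst (falphabet FG) (fsubst FG) \<and>
     faxiom FG \<in> lists (falphabet FG) \<and>
     bij_betw (production FG) (labels FG) (SIGMA a:falphabet FG. fsubst FG a) \<and>
     (\<forall>r\<in>labels FG. grade FG r \<in> {0..1}) \<and>
     (\<forall>a\<in>falphabet FG. (\<Sum>r\<in>labels_of FG a. grade FG r) \<noteq> 0)"

definition mu :: "'a fuzzy_0L \<Rightarrow> nat \<Rightarrow> real" where
  "mu FG r = grade FG r / (\<Sum>s\<in>labels_of FG (fst (production FG r)). grade FG s)"

definition mu_word :: "'a fuzzy_0L \<Rightarrow> nat list \<Rightarrow> real" where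
  "mu_word FG \<alpha> = prod_list (map (mu FG) \<alpha>)"

definition label_words :: "'a fuzzy_0L \<Rightarrow> 'a list \<Rightarrow> nat list set" where
  "label_words FG w = {\<alpha>. list_all2 (\<lambda>r a. r \<in> labels_of FG a) \<alpha> w}"

text \<open>Summands with \<open>\<mu>(\<alpha>) = 0\<close> vanish, in accordance with the convention
  \<open>0 log 0 = 0\<close>.\<close>

definition fuzzy_entropy :: "'a fuzzy_0L \<Rightarrow> 'a list \<Rightarrow> real" where
  "fuzzy_entropy FG w =
     (if w = [] then 0
      else - (\<Sum>\<alpha>\<in>label_words FG w. mu_word FG \<alpha> * log 2 (mu_word FG \<alpha>)))"

definition bounded_entropy_lang :: "'a fuzzy_0L \<Rightarrow> real \<Rightarrow> 'a list set" where
  "bounded_entropy_lang FG c =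
     {w \<in> generated (fsubst FG) (faxiom FG). fuzzy_entropy FG w \<le> c}"

definition class_BFEL :: "'a list set set" where
  "class_BFEL = {bounded_entropy_lang FG c | FG c. is_fuzzy_0L FG \<and> c \<ge> 0}"

end

theory Submission imports Defs begin

text \<open>The entropy is additive: \<open>E(a\<^sub>1\<dots>a\<^sub>m) = E(a\<^sub>1) + \<dots> + E(a\<^sub>m)\<close>, with every summand nonnegative.
  A bounded entropy language is therefore a 0L language cut down by a bound on the total weight of a
  word. Only finitely many values up to the bound are total weights, so an E0L system can annotate
  each symbol with the weight its descendants are going to have; a symbol is terminal when its
  annotation is its own weight. Conversely, a symbol has entropy zero iff its distribution is
  concentrated on one production, so grades can be chosen that make exactly the terminals have
  entropy zero (adding, for every symbol, a production into a dead symbol), and the bound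
  \<open>c = 0\<close> then selects the terminal words.\<close>

section \<open>Generated languages\<close>

lemma subst_word_Nil [simp]: "subst_word h [] = {[]}"
  by (auto simp: subst_word_def)

lemma subst_word_Cons: "subst_word h (a # w) = {u @ v | u v. u \<in> h a \<and> v \<in> subst_word h w}"
proof (intro equalityI subsetI)
  fix x assume "x \<in> subst_word h (a # w)"
  then show "x \<in> {u @ v | u v. u \<in> h a \<and> v \<in> subst_word h w}"
    by (fastforce simp: subst_word_def list_all2_Cons2)
next
  fix x assume "x \<in> {u @ v | u v. u \<in> h a \<and> v \<in> subst_word h w}"
  then obtain u us where "x = u @ concat us" "u \<in> h a" "list_all2 (\<lambda>u a. u \<in> h a) us w"
    by (auto simp: subst_word_def)
  then show "x \<in> subst_word h (a # w)"
    unfolding subst_word_def by (auto intro!: exI[of _ "u # us"])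
qed

lemma subst_word_single [simp]: "subst_word h [a] = h a"
  by (auto simp: subst_word_Cons)

lemma generated_axiom: "\<omega> \<in> generated h \<omega>"
  unfolding generated_def by (rule UN_I[of 0]) auto

lemma generated_step:
  assumes "u \<in> generated h \<omega>" "v \<in> subst_word h u"
  shows "v \<in> generated h \<omega>"
proof -
  obtain i where "u \<in> (subst_lang h ^^ i) {\<omega>}"
    using assms(1) by (auto simp: generated_def)
  then have "v \<in> (subst_lang h ^^ Suc i) {\<omega>}"
    using assms(2) by (auto simp: subst_lang_def)
  then show ?thesis unfolding generated_def by blast
qed

lemma generated_induct [consumes 1, case_names axiom step]:
  assumes "w \<in> generated h \<omega>"
    and "P \<omega>"
    and "\<And>u v. u \<in> generated h \<omega> \<Longrightarrow> P u \<Longrightarrow> v \<in> subst_word h u \<Longrightarrow> P v"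
  shows "P w"
proof -
  have "\<forall>w \<in> (subst_lang h ^^ i) {\<omega>}. P w" for i
  proof (induction i)
    case 0
    then show ?case using assms(2) by simp
  next
    case (Suc i)
    show ?case
    proof
      fix w assume "w \<in> (subst_lang h ^^ Suc i) {\<omega>}"
      then obtain u where u: "u \<in> (subst_lang h ^^ i) {\<omega>}" "w \<in> subst_word h u"
        by (auto simp: subst_lang_def)
      then show "P w" using Suc assms(3)[of u w] unfolding generated_def by blast
    qed
  qed
  then show ?thesis using assms(1) by (auto simp: generated_def)
qed

lemma subst_word_in_lists:
  assumes "\<And>a. a \<in> \<Sigma> \<Longrightarrow> h a \<subseteq> lists \<Sigma>" "w \<in> lists \<Sigma>"
  shows "subst_word h w \<subseteq> lists \<Sigma>"
  using assms(2)
proof (induction w)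
  case (Cons a w)
  then show ?case using assms(1) by (fastforce simp: subst_word_Cons)
qed auto

lemma generated_in_lists:
  assumes "\<And>a. a \<in> \<Sigma> \<Longrightarrow> h a \<subseteq> lists \<Sigma>" "\<omega> \<in> lists \<Sigma>"
  shows "generated h \<omega> \<subseteq> lists \<Sigma>"
proof
  fix w assume "w \<in> generated h \<omega>"
  then show "w \<in> lists \<Sigma>"
    by (induction rule: generated_induct) (use assms subst_word_in_lists in blast)+
qed

section \<open>Restriction of derivations to a subalphabet\<close>

text \<open>A symbol outside \<open>S\<close> puts a block outside \<open>lists S\<close> into every
  successor. So a successor over \<open>S\<close> has a predecessor over \<open>S\<close>, and there
  both substitutions offer the same blocks over \<open>S\<close>.\<close>

lemma subst_word_Int_lists:
  assumes "\<And>a. a \<in> S \<Longrightarrow> h' a \<inter> lists S = h a"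
    and "\<And>a. a \<in> \<Sigma> - S \<Longrightarrow> h' a \<inter> lists S = {}"
    and "u \<in> lists \<Sigma>" "v \<in> subst_word h' u" "v \<in> lists S"
  shows "u \<in> lists S \<and> v \<in> subst_word h u"
  using assms(3-)
proof (induction u arbitrary: v)
  case (Cons a u)
  then obtain x y where xy: "v = x @ y" "x \<in> h' a" "y \<in> subst_word h' u"
    by (auto simp: subst_word_Cons)
  with Cons.prems have "x \<in> lists S" "y \<in> lists S" by auto
  moreover have "a \<in> \<Sigma>" using Cons.hyps by simp
  ultimately have "a \<in> S" using xy(2) assms(2)[of a] by blast
  then have "x \<in> h a" using xy(2) \<open>x \<in> lists S\<close> assms(1) by blast
  then show ?case using Cons xy \<open>a \<in> S\<close> \<open>y \<in> lists S\<close> by (auto simp: subst_word_Cons)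
qed auto

lemma subst_word_mono:
  assumes "\<And>a. a \<in> set w \<Longrightarrow> h a \<subseteq> h' a"
  shows "subst_word h w \<subseteq> subst_word h' w"
  using assms
proof (induction w)
  case (Cons a w)
  then have "h a \<subseteq> h' a" "subst_word h w \<subseteq> subst_word h' w" by auto
  then show ?case by (auto simp: subst_word_Cons)
qed simp

text \<open>Going backwards step by step, a derivation in \<open>h'\<close> that ends over
  \<open>S\<close> has been over \<open>S\<close> all along. This removes the dead symbol in each
  construction that adds one.\<close>

lemma generated_Int_lists:
  assumes S: "\<And>a. a \<in> S \<Longrightarrow> h' a \<inter> lists S = h a"
    and dead: "\<And>a. a \<in> \<Sigma> - S \<Longrightarrow> h' a \<inter> lists S = {}"
    and \<Sigma>: "\<And>a. a \<in> \<Sigma> \<Longrightarrow> h' a \<subseteq> lists \<Sigma>" "S \<subseteq> \<Sigma>"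
    and \<omega>: "\<omega> \<in> lists S"
  shows "generated h' \<omega> \<inter> lists S = generated h \<omega>"
proof (intro equalityI subsetI)
  have \<omega>': "\<omega> \<in> lists \<Sigma>" using \<omega> \<Sigma>(2) lists_mono by blast
  fix w assume "w \<in> generated h' \<omega> \<inter> lists S"
  then have "w \<in> generated h' \<omega>" "w \<in> lists S" by auto
  then show "w \<in> generated h \<omega>"
  proof (induction rule: generated_induct)
    case axiom
    show ?case by (rule generated_axiom)
  next
    case (step u v)
    have "u \<in> lists \<Sigma>" using generated_in_lists[of \<Sigma> h' \<omega>] \<Sigma>(1) \<omega>' step.hyps(1) by blast
    then have "u \<in> lists S \<and> v \<in> subst_word h u"
      using subst_word_Int_lists[of S h' h \<Sigma> u v] S dead step by blast
    then show ?case using step generated_step by blast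
  qed
next
  have h: "h a \<subseteq> lists S" "h a \<subseteq> h' a" if "a \<in> S" for a
    using S[OF that] by auto
  fix w assume w: "w \<in> generated h \<omega>"
  then have "w \<in> generated h' \<omega>"
  proof (induction rule: generated_induct)
    case axiom
    show ?case by (rule generated_axiom)
  next
    case (step u v)
    have "u \<in> lists S" using generated_in_lists[of S h \<omega>] h \<omega> step.hyps(1) by blast
    then have "subst_word h u \<subseteq> subst_word h' u" using h(2) by (intro subst_word_mono) auto
    then show ?case using step generated_step by blast
  qed
  moreover have "w \<in> lists S" using generated_in_lists[of S h \<omega>] h \<omega> w by blast
  ultimately show "w \<in> generated h' \<omega> \<inter> lists S" by simp
qed

text \<open>Unlike in \<^const>\<open>is_finite_subst\<close>, symbols without any production are allowed here.\<close>

lemma generated_Int_lists_in_class_E0L: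
  fixes h :: "'a::infinite \<Rightarrow> 'a list set"
  assumes fin: "finite \<Sigma>" and h: "\<And>a. a \<in> \<Sigma> \<Longrightarrow> finite (h a) \<and> h a \<subseteq> lists \<Sigma>"
    and \<omega>: "\<omega> \<in> lists \<Sigma>" and \<Delta>: "\<Delta> \<subseteq> \<Sigma>"
  shows "generated h \<omega> \<inter> lists \<Delta> \<in> class_E0L"
proof -
  obtain d where d: "d \<notin> \<Sigma>" using fin ex_new_if_finite infinite_UNIV by blast
  \<comment> \<open>\<open>[d]\<close> gives every symbol a production, and \<open>d\<close> only
    reproduces itself, so a word containing \<open>d\<close> never leads back to
    \<open>lists \<Sigma>\<close>.\<close>
  define h' where "h' a = (if a \<in> \<Sigma> then insert [d] (h a) else {[d]})" for a
  define G where "G = \<lparr>alphabet = insert d \<Sigma>, subst = h', axiom_word = \<omega>, terminals = \<Delta>\<rparr>"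
  have h'l: "h' a \<subseteq> lists (insert d \<Sigma>)" if "a \<in> insert d \<Sigma>" for a
    using h[of a] lists_mono[of \<Sigma> "insert d \<Sigma>"] by (auto simp: h'_def)
  have "is_E0L G"
    using fin h h'l \<omega> \<Delta> lists_mono[of \<Sigma> "insert d \<Sigma>"]
    by (auto simp: is_E0L_def G_def is_finite_subst_def h'_def)
  moreover have "generated h' \<omega> \<inter> lists \<Sigma> = generated h \<omega>"
  proof (rule generated_Int_lists[where \<Sigma> = "insert d \<Sigma>"])
    show "h' a \<inter> lists \<Sigma> = h a" if "a \<in> \<Sigma>" for a using that h d by (fastforce simp: h'_def)
    show "h' a \<inter> lists \<Sigma> = {}" if "a \<in> insert d \<Sigma> - \<Sigma>" for a using that d by (auto simp: h'_def)
  qed (use h'l \<omega> in auto)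
  then have "E0L_lang G = generated h \<omega> \<inter> lists \<Delta>"
    using lists_mono[OF \<Delta>] by (auto simp: E0L_lang_def G_def)
  ultimately show ?thesis unfolding class_E0L_def by blast
qed

section \<open>Injective renaming of symbols\<close>

lemma subst_word_relabel:
  assumes g: "inj_on g \<Sigma>" and "w \<in> lists \<Sigma>"
  shows "subst_word (\<lambda>y. map g ` h (inv_into \<Sigma> g y)) (map g w) = map g ` subst_word h w"
  using assms(2)
proof (induction w)
  case (Cons a w)
  then have "a \<in> \<Sigma>" by simp
  then have "inv_into \<Sigma> g (g a) = a" using g by simp
  then have "subst_word (\<lambda>y. map g ` h (inv_into \<Sigma> g y)) (map g (a # w)) =
      {map g u @ v | u v. u \<in> h a \<and> v \<in> map g ` subst_word h w}"
    using Cons by (auto simp: subst_word_Cons)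
  also have "\<dots> = {map g (u @ v) | u v. u \<in> h a \<and> v \<in> subst_word h w}" by auto
  also have "\<dots> = map g ` subst_word h (a # w)" unfolding subst_word_Cons by blast
  finally show ?case .
qed simp

lemma generated_relabel:
  assumes g: "inj_on g \<Sigma>" and h: "\<And>a. a \<in> \<Sigma> \<Longrightarrow> h a \<subseteq> lists \<Sigma>" and \<omega>: "\<omega> \<in> lists \<Sigma>"
  shows "generated (\<lambda>y. map g ` h (inv_into \<Sigma> g y)) (map g \<omega>) = map g ` generated h \<omega>"
    (is "generated ?h _ = _")
proof -
  have l: "u \<in> lists \<Sigma>" if "u \<in> generated h \<omega>" for u
    using generated_in_lists[of \<Sigma> h \<omega>] h \<omega> that by blast
  show ?thesis
  proof (intro equalityI subsetI)
    fix w assume "w \<in> generated ?h (map g \<omega>)"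
    then show "w \<in> map g ` generated h \<omega>"
    proof (induction rule: generated_induct)
      case axiom
      show ?case by (simp add: generated_axiom)
    next
      case (step u v)
      then obtain u' where u': "u = map g u'" "u' \<in> generated h \<omega>" by auto
      then have "v \<in> map g ` subst_word h u'"
        using step.hyps(2) subst_word_relabel[OF g l] by metis
      then show ?case using u'(2) generated_step by blast
    qed
  next
    fix w assume "w \<in> map g ` generated h \<omega>"
    then obtain w' where "w' \<in> generated h \<omega>" "w = map g w'" by auto
    from this(1) have "map g w' \<in> generated ?h (map g \<omega>)"
    proof (induction rule: generated_induct)
      case axiom
      show ?case by (rule generated_axiom)
    next
      case (step u v)
      then have "map g v \<in> subst_word ?h (map g u)"
        using subst_word_relabel[OF g l] by blast
      then show ?case using step.IH generated_step by blast
    qed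
    then show "w \<in> generated ?h (map g \<omega>)" using \<open>w = map g w'\<close> by simp
  qed
qed

text \<open>The annotated system has symbols in \<open>('a \<times> real) option\<close>, whereas
  the class fixes the type \<open>'a\<close>; an injective renaming bridges the two. Injectivity of
  \<open>map g\<close> makes the image commute with the intersection with
  \<open>lists \<Delta>\<close>.\<close>

lemma relabelled_in_class_E0L:
  fixes g :: "'b \<Rightarrow> 'a::infinite"
  assumes fin: "finite \<Sigma>" and h: "\<And>a. a \<in> \<Sigma> \<Longrightarrow> finite (h a) \<and> h a \<subseteq> lists \<Sigma>"
    and \<omega>: "\<omega> \<in> lists \<Sigma>" and \<Delta>: "\<Delta> \<subseteq> \<Sigma>" and g: "inj_on g \<Sigma>"
  shows "map g ` (generated h \<omega> \<inter> lists \<Delta>) \<in> class_E0L"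
proof -
  let ?h = "\<lambda>y. map g ` h (inv_into \<Sigma> g y)"
  have inj: "inj_on (map g) (lists \<Sigma>)" using g by (simp add: inj_on_mapI inj_on_map_lists)
  have "generated h \<omega> \<subseteq> lists \<Sigma>" using generated_in_lists[of \<Sigma> h \<omega>] h \<omega> by blast
  then have "map g ` (generated h \<omega> \<inter> lists \<Delta>) = map g ` generated h \<omega> \<inter> map g ` lists \<Delta>"
    using inj_on_image_Int[OF inj _ lists_mono[OF \<Delta>]] by blast
  also have "\<dots> = generated ?h (map g \<omega>) \<inter> lists (g ` \<Delta>)"
    using generated_relabel[of g \<Sigma> h \<omega>] g h \<omega> by (simp add: lists_image)
  also have "\<dots> \<in> class_E0L"
  proof (rule generated_Int_lists_in_class_E0L[where \<Sigma> = "g ` \<Sigma>"])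
    show "finite (?h a) \<and> ?h a \<subseteq> lists (g ` \<Sigma>)" if "a \<in> g ` \<Sigma>" for a
    proof -
      from that obtain b where b: "b \<in> \<Sigma>" "inv_into \<Sigma> g a = b" using g by auto
      then show ?thesis using h[of b] by (auto simp: lists_image)
    qed
  qed (use fin \<omega> \<Delta> in auto)
  finally show ?thesis .
qed

section \<open>Cutting a 0L language down by weight\<close>

text \<open>Deleting letters of weight zero keeps the total. Each remaining letter weighs at least
  some \<open>e > 0\<close>, so at most \<open>c / e\<close> of them fit under the bound, and only
  finitely many words are that short.\<close>

lemma finite_bounded_weights:
  fixes wt :: "'a \<Rightarrow> real"
  assumes fin: "finite \<Sigma>" and nn: "\<And>a. a \<in> \<Sigma> \<Longrightarrow> wt a \<ge> 0"
  shows "finite ((\<lambda>w. sum_list (map wt w)) ` lists \<Sigma> \<inter> {..c})"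
proof -
  define P where "P = {a \<in> \<Sigma>. wt a > 0}"
  \<comment> \<open>\<open>insert 1\<close> keeps the minimum defined and positive when no letter
    has positive weight.\<close>
  define e where "e = Min (insert 1 (wt ` P))"
  have fP: "finite P" using fin by (simp add: P_def)
  have e: "e > 0" "\<And>a. a \<in> P \<Longrightarrow> e \<le> wt a"
    using fP by (auto simp: e_def P_def)
  have filt: "sum_list (map wt (filter (\<lambda>a. wt a > 0) w)) = sum_list (map wt w)"
    if "w \<in> lists \<Sigma>" for w
    using that by (induction w) (auto dest!: nn)
  have len: "e * real (length w) \<le> sum_list (map wt w)" if "w \<in> lists P" for w
    using that by (induction w) (auto simp: algebra_simps dest!: e(2))
  have "(\<lambda>w. sum_list (map wt w)) ` lists \<Sigma> \<inter> {..c}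
      \<subseteq> (\<lambda>w. sum_list (map wt w)) ` {w. set w \<subseteq> P \<and> length w \<le> nat \<lfloor>c / e\<rfloor>}"
  proof
    fix k assume "k \<in> (\<lambda>w. sum_list (map wt w)) ` lists \<Sigma> \<inter> {..c}"
    then obtain w where w: "w \<in> lists \<Sigma>" "k = sum_list (map wt w)" "k \<le> c" by auto
    define v where "v = filter (\<lambda>a. wt a > 0) w"
    have v: "set v \<subseteq> P" "k = sum_list (map wt v)"
      using w filt by (auto simp: v_def P_def)
    then have "e * real (length v) \<le> c" using len[of v] w by (auto simp: in_lists_conv_set subset_eq)
    then have "real (length v) \<le> c / e" using e(1) by (simp add: field_simps)
    then have "length v \<le> nat \<lfloor>c / e\<rfloor>" by linarith
    then show "k \<in> (\<lambda>w. sum_list (map wt w)) ` {w. set w \<subseteq> P \<and> length w \<le> nat \<lfloor>c / e\<rfloor>}"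
      using v by auto
  qed
  then show ?thesis using finite_lists_length_le[OF fP] finite_subset by blast
qed

section \<open>Annotated derivations\<close>

lemma finite_annotations:
  assumes "finite A" "finite K"
  shows "finite {us. map fst us \<in> A \<and> snd ` set us \<subseteq> K}"
proof -
  have "finite {us. map fst us = w \<and> snd ` set us \<subseteq> K}" for w
  proof (rule finite_subset)
    show "{us. map fst us = w \<and> snd ` set us \<subseteq> K} \<subseteq> {us. set us \<subseteq> set w \<times> K \<and> length us \<le> length w}"
      by (force simp: image_subset_iff)
    show "finite {us. set us \<subseteq> set w \<times> K \<and> length us \<le> length w}"
      using assms(2) by (intro finite_lists_length_le) auto
  qed
  then have "finite (\<Union>w\<in>A. {us. map fst us = w \<and> snd ` set us \<subseteq> K})" using assms(1) by blast
  also have "(\<Union>w\<in>A. {us. map fst us = w \<and> snd ` set us \<subseteq> K}) = {us. map fst us \<in> A \<and> snd ` set us \<subseteq> K}"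
    by auto
  finally show ?thesis .
qed

text \<open>The start symbol is \<^term>\<open>None\<close>. The symbol \<^term>\<open>Some (a, k)\<close> is an occurrence of \<open>a\<close>
  whose descendants in the final word are promised to have total weight \<open>k\<close>.\<close>

fun annot_subst ::
  "real set \<Rightarrow> real \<Rightarrow> ('a \<Rightarrow> 'a list set) \<Rightarrow> 'a list \<Rightarrow> ('a \<times> real) option \<Rightarrow> ('a \<times> real) option list set"
where
  "annot_subst K c h \<omega> None =
     map Some ` {us. map fst us \<in> {\<omega>} \<and> snd ` set us \<subseteq> K \<and> sum_list (map snd us) \<le> c}"
| "annot_subst K c h \<omega> (Some (a, k)) =
     map Some ` {us. map fst us \<in> h a \<and> snd ` set us \<subseteq> K \<and> sum_list (map snd us) = k}"

text \<open>A production splits its promise \<open>k\<close> exactly among the symbols it creates,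
  so the total promise survives a step, and erasing the promises leaves a step of
  \<open>h\<close>.\<close>

lemma subst_word_annot_sound:
  assumes "y \<in> subst_word (annot_subst K c h \<omega>) (map Some us)"
  shows "\<exists>us'. y = map Some us' \<and> map fst us' \<in> subst_word h (map fst us) \<and>
           snd ` set us' \<subseteq> K \<and> sum_list (map snd us') = sum_list (map snd us)"
  using assms
proof (induction us arbitrary: y)
  case (Cons p us)
  obtain a k where p: "p = (a, k)" by fastforce
  from Cons.prems obtain xs z where xs: "y = map Some xs @ z" "map fst xs \<in> h a"
      "snd ` set xs \<subseteq> K" "sum_list (map snd xs) = k"
      and z: "z \<in> subst_word (annot_subst K c h \<omega>) (map Some us)"
    by (auto simp: subst_word_Cons p)
  from Cons.IH[OF z] obtain zs where "z = map Some zs" "map fst zs \<in> subst_word h (map fst us)"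
    "snd ` set zs \<subseteq> K" "sum_list (map snd zs) = sum_list (map snd us)" by blast
  then show ?case using xs
    by (intro exI[of _ "xs @ zs"]) (auto simp: subst_word_Cons p)
qed simp

text \<open>Read backwards, the promise of a symbol is forced: it is the sum of the promises in its
  block. Closure of \<open>K\<close> under sums up to \<open>c\<close> makes that sum an admissible
  annotation.\<close>

lemma subst_word_annot_complete:
  assumes K: "\<And>ks. set ks \<subseteq> K \<Longrightarrow> sum_list ks \<le> c \<Longrightarrow> sum_list ks \<in> K"
    and nn: "\<And>k. k \<in> K \<Longrightarrow> k \<ge> 0"
    and "map fst us' \<in> subst_word h v" "snd ` set us' \<subseteq> K" "sum_list (map snd us') \<le> c"
  shows "\<exists>us. map fst us = v \<and> snd ` set us \<subseteq> K \<and> sum_list (map snd us) = sum_list (map snd us') \<and>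
           map Some us' \<in> subst_word (annot_subst K c h \<omega>) (map Some us)"
  using assms(3-)
proof (induction v arbitrary: us')
  case (Cons a v)
  from Cons.prems obtain xs zs where us': "us' = xs @ zs"
      and xs: "map fst xs \<in> h a" and zs: "map fst zs \<in> subst_word h v"
    by (auto simp: subst_word_Cons map_eq_append_conv)
  \<comment> \<open>No promise is negative, so each part of \<open>us'\<close> obeys the bound of
    the whole, as the closure of \<open>K\<close> and the induction hypothesis require.\<close>
  have "sum_list (map snd xs) \<ge> 0" "sum_list (map snd zs) \<ge> 0"
    using Cons.prems nn us' by (fastforce intro!: sum_list_nonneg)+
  then have le: "sum_list (map snd xs) \<le> c" "sum_list (map snd zs) \<le> c"
    using Cons.prems us' by auto
  have "snd ` set zs \<subseteq> K" using Cons.prems us' by auto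
  from Cons.IH[OF zs this le(2)] obtain us where us: "map fst us = v" "snd ` set us \<subseteq> K"
      "sum_list (map snd us) = sum_list (map snd zs)"
      "map Some zs \<in> subst_word (annot_subst K c h \<omega>) (map Some us)" by blast
  have "sum_list (map snd xs) \<in> K" using K[of "map snd xs"] Cons.prems us' le by auto
  moreover have "map Some xs \<in> annot_subst K c h \<omega> (Some (a, sum_list (map snd xs)))"
    using Cons.prems(2) us' xs by auto
  ultimately show ?case using us us'
    by (intro exI[of _ "(a, sum_list (map snd xs)) # us"])
      (auto simp: subst_word_Cons simp del: annot_subst.simps)
qed simp

text \<open>The start production bounds the total promise and every later step preserves it;
  conversely, any annotation within the bound can be traced back, step by step, to the start
  symbol.\<close>

lemma generated_annot:
  assumes K: "\<And>ks. set ks \<subseteq> K \<Longrightarrow> sum_list ks \<le> c \<Longrightarrow> sum_list ks \<in> K"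
    and nn: "\<And>k. k \<in> K \<Longrightarrow> k \<ge> 0"
  shows "generated (annot_subst K c h \<omega>) [None] = insert [None]
    (map Some ` {us. map fst us \<in> generated h \<omega> \<and> snd ` set us \<subseteq> K \<and> sum_list (map snd us) \<le> c})"
    (is "?L = insert _ (map Some ` ?R)")
proof (intro equalityI subsetI)
  fix w assume "w \<in> ?L"
  then show "w \<in> insert [None] (map Some ` ?R)"
  proof (induction rule: generated_induct)
    case (step u v)
    from step.IH consider "u = [None]" | us where "u = map Some us" "us \<in> ?R" by blast
    then show ?case
    proof cases
      case 1
      then show ?thesis using step.hyps(2) generated_axiom[of \<omega> h] by auto
    next
      case 2
      from subst_word_annot_sound[of v K c h \<omega> us] step.hyps(2) 2(1)
      obtain us' where "v = map Some us'" "map fst us' \<in> subst_word h (map fst us)"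
        "snd ` set us' \<subseteq> K" "sum_list (map snd us') = sum_list (map snd us)" by blast
      moreover from this have "map fst us' \<in> generated h \<omega>"
        using 2(2) generated_step[of "map fst us" h \<omega>] by simp
      ultimately show ?thesis using 2(2) by auto
    qed
  qed simp
next
  \<comment> \<open>All annotations of \<open>v\<close> are treated at once, because the annotation
    of a predecessor is dictated by that of its successor.\<close>
  have *: "\<forall>us. map fst us = v \<longrightarrow> snd ` set us \<subseteq> K \<longrightarrow> sum_list (map snd us) \<le> c \<longrightarrow> map Some us \<in> ?L"
    if "v \<in> generated h \<omega>" for v
    using that
  proof (induction rule: generated_induct)
    case axiom
    have "map Some us \<in> subst_word (annot_subst K c h \<omega>) [None]"
      if "map fst us = \<omega>" "snd ` set us \<subseteq> K" "sum_list (map snd us) \<le> c" for us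
      using that by auto
    then show ?case using generated_step[OF generated_axiom] by blast
  next
    case (step u v)
    show ?case
    proof (intro allI impI)
      fix us' assume us': "map fst us' = v" "snd ` set us' \<subseteq> K" "sum_list (map snd us') \<le> c"
      then have "map fst us' \<in> subst_word h u" using step.hyps(2) by simp
      from subst_word_annot_complete[OF K nn this us'(2,3)] obtain us
        where "map fst us = u" "snd ` set us \<subseteq> K" "sum_list (map snd us) = sum_list (map snd us')"
          "map Some us' \<in> subst_word (annot_subst K c h \<omega>) (map Some us)" by blast
      then show "map Some us' \<in> ?L" using step.IH us'(3) generated_step by metis
    qed
  qed
  fix w assume "w \<in> insert [None] (map Some ` ?R)"
  then show "w \<in> ?L" using * generated_axiom by auto
qed

section \<open>Return to the original symbol type\<close>

text \<open>An infinite type has enough values outside the image of \<open>B\<close> for the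
  finitely many other elements. This allows a renaming under which annotated terminals regain their
  letters.\<close>

lemma inj_on_extend_fresh:
  fixes f :: "'b \<Rightarrow> 'a::infinite"
  assumes A: "finite A" and B: "B \<subseteq> A" and f: "inj_on f B"
  shows "\<exists>g. inj_on g A \<and> (\<forall>b\<in>B. g b = f b)"
proof -
  have "infinite (UNIV - f ` B)"
    using finite_subset[OF B A] infinite_UNIV by (simp add: Diff_infinite_finite)
  then obtain T where T: "T \<subseteq> UNIV - f ` B" "finite T" "card T = card (A - B)"
    using infinite_arbitrarily_large[of "UNIV - f ` B" "card (A - B)"] by auto
  then obtain e where e: "bij_betw e (A - B) T"
    using finite_same_card_bij[of "A - B" T] A by auto
  define g where "g x = (if x \<in> B then f x else e x)" for x
  have "e x \<notin> f ` B" if "x \<in> A - B" for x using bij_betwE[OF e] that T(1) by blast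
  then have "inj_on g A"
    using f bij_betw_imp_inj_on[OF e] unfolding inj_on_def g_def by (smt (verit) DiffI imageI)
  then show ?thesis by (auto simp: g_def)
qed

text \<open>In a terminal word every letter promises its own weight, so the total promise, bounded
  by \<open>c\<close> from the start, is the total weight.\<close>

lemma weight_bounded_in_class_E0L:
  fixes h :: "'a::infinite \<Rightarrow> 'a list set" and wt :: "'a \<Rightarrow> real"
  assumes fin: "finite \<Sigma>" and h: "is_finite_subst \<Sigma> h" and \<omega>: "\<omega> \<in> lists \<Sigma>"
    and nn: "\<And>a. a \<in> \<Sigma> \<Longrightarrow> wt a \<ge> 0"
  shows "{w \<in> generated h \<omega>. sum_list (map wt w) \<le> c} \<in> class_E0L"
proof -
  define K where "K = (\<lambda>w. sum_list (map wt w)) ` lists \<Sigma> \<inter> {..c}"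
  have finK: "finite K" unfolding K_def by (rule finite_bounded_weights[OF fin nn])
  have Knn: "k \<ge> 0" if "k \<in> K" for k
    using that nn by (auto simp: K_def in_lists_conv_set intro!: sum_list_nonneg)
  \<comment> \<open>Concatenating words adds their weights; cut off at \<open>c\<close>, this is the
    closure that \<open>K\<close> has to satisfy.\<close>
  have "sum_list ks \<in> (\<lambda>w. sum_list (map wt w)) ` lists \<Sigma>" if "set ks \<subseteq> K" for ks
    using that
  proof (induction ks)
    case Nil
    show ?case by (auto intro!: image_eqI[of _ _ "[]"])
  next
    case (Cons k ks)
    then obtain u v where "u \<in> lists \<Sigma>" "v \<in> lists \<Sigma>" "k = sum_list (map wt u)"
        "sum_list ks = sum_list (map wt v)" by (auto simp: K_def)
    then show ?case by (intro image_eqI[of _ _ "u @ v"]) auto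
  qed
  then have K: "sum_list ks \<in> K" if "set ks \<subseteq> K" "sum_list ks \<le> c" for ks
    using that by (auto simp: K_def)
  define A where "A = insert None (Some ` (\<Sigma> \<times> K))"
  \<comment> \<open>Letters heavier than \<open>c\<close> are left out: their weight is not in
    \<open>K\<close>, and by nonnegativity they occur in no word within the bound.\<close>
  define D where "D = (\<lambda>a. Some (a, wt a)) ` {a \<in> \<Sigma>. wt a \<le> c}"
  have wtK: "wt a \<in> K" if "a \<in> \<Sigma>" "wt a \<le> c" for a
    using that by (auto simp: K_def intro!: image_eqI[of _ _ "[a]"])
  then have DA: "D \<subseteq> A" by (auto simp: A_def D_def)
  have finA: "finite A" using fin finK by (simp add: A_def)
  \<comment> \<open>The promise \<open>wt a\<close> is a function of \<open>a\<close>, so a terminal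
    is determined by its letter and \<open>g\<close> can send it back there.\<close>
  have "inj_on (fst \<circ> the) D" by (auto simp: D_def inj_on_def)
  then obtain g where g: "inj_on g A" "\<And>b. b \<in> D \<Longrightarrow> g b = fst (the b)"
    using inj_on_extend_fresh[OF finA DA] by force
  let ?h = "annot_subst K c h \<omega>"
  have annot_lists: "map Some us \<in> lists A" if "map fst us \<in> lists \<Sigma>" "snd ` set us \<subseteq> K" for us
    using that by (force simp: A_def in_lists_conv_set image_subset_iff)
  have hA: "finite (?h x) \<and> ?h x \<subseteq> lists A" if "x \<in> A" for x
  proof (cases x)
    case None
    have "finite {us. map fst us \<in> {\<omega>} \<and> snd ` set us \<subseteq> K \<and> sum_list (map snd us) \<le> c}"
      by (rule finite_subset[OF _ finite_annotations[of "{\<omega>}" K]]) (use finK in auto)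
    then show ?thesis using None annot_lists \<omega> by auto
  next
    case (Some p)
    obtain a k where p: "p = (a, k)" by fastforce
    have a: "finite (h a)" "h a \<subseteq> lists \<Sigma>"
      using that Some p h by (auto simp: A_def is_finite_subst_def)
    have "finite {us. map fst us \<in> h a \<and> snd ` set us \<subseteq> K \<and> sum_list (map snd us) = k}"
      by (rule finite_subset[OF _ finite_annotations[of "h a" K]]) (use finK a in auto)
    moreover have "?h x \<subseteq> lists A" unfolding Some p using annot_lists a(2) by auto
    ultimately show ?thesis using Some p by simp
  qed
  have gen: "generated ?h [None] = insert [None] (map Some `
      {us. map fst us \<in> generated h \<omega> \<and> snd ` set us \<subseteq> K \<and> sum_list (map snd us) \<le> c})"
    by (rule generated_annot) (fact K Knn)+
  have sub: "sum_list (map snd us) = sum_list (map wt (map fst us)) \<and>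
      map g (map Some us) = map fst us" if "map Some us \<in> lists D" for us
    using that g(2) by (induction us) (auto simp: D_def)
  have "map g ` (generated ?h [None] \<inter> lists D) = {w \<in> generated h \<omega>. sum_list (map wt w) \<le> c}"
  proof (intro equalityI subsetI)
    fix w assume "w \<in> map g ` (generated ?h [None] \<inter> lists D)"
    then obtain x where x: "x \<in> generated ?h [None]" "x \<in> lists D" "w = map g x" by auto
    \<comment> \<open>The start word has no counterpart in the 0L language; it drops out because
      \<open>None\<close> is not terminal.\<close>
    then have "x \<noteq> [None]" by (auto simp: D_def)
    with x(1) obtain us where us: "x = map Some us" "map fst us \<in> generated h \<omega>"
        "sum_list (map snd us) \<le> c"
      unfolding gen by auto
    then show "w \<in> {w \<in> generated h \<omega>. sum_list (map wt w) \<le> c}"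
      using sub[of us] x(2,3) by (simp del: map_map in_lists_conv_set)
  next
    fix w assume "w \<in> {w \<in> generated h \<omega>. sum_list (map wt w) \<le> c}"
    then have w: "w \<in> generated h \<omega>" "sum_list (map wt w) \<le> c" by auto
    have w\<Sigma>: "w \<in> lists \<Sigma>"
      using generated_in_lists[of \<Sigma> h \<omega>] h \<omega> w(1) by (auto simp: is_finite_subst_def)
    have wtc: "wt a \<le> c" if "a \<in> set w" for a
    proof -
      have "wt a \<le> sum_list (map wt w)"
        using that w\<Sigma> nn by (intro member_le_sum_list) auto
      then show ?thesis using w(2) by simp
    qed
    \<comment> \<open>Promising each letter its own weight makes every annotated letter terminal and
      the total promise the weight of \<open>w\<close>.\<close>
    define us where "us = map (\<lambda>a. (a, wt a)) w"
    have 1: "map fst us = w" "map snd us = map wt w" by (simp_all add: us_def comp_def)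
    have 2: "snd ` set us \<subseteq> K" using w\<Sigma> wtc wtK by (auto simp: us_def)
    have 3: "map Some us \<in> lists D" using w\<Sigma> wtc by (auto simp: us_def D_def)
    have "map Some us \<in> generated ?h [None]"
      unfolding gen using 1 2 w by (simp add: image_iff)
    then show "w \<in> map g ` (generated ?h [None] \<inter> lists D)"
      using 3 sub[OF 3] 1(1) by (intro image_eqI[of _ _ "map Some us"]) auto
  qed
  moreover have "map g ` (generated ?h [None] \<inter> lists D) \<in> class_E0L"
    by (rule relabelled_in_class_E0L[OF finA hA _ DA g(1)]) (auto simp: A_def)
  ultimately show ?thesis by simp
qed

section \<open>Entropy\<close>

text \<open>Shannon entropy, in bits, of the random choice of a production for
  \<open>a\<close>.\<close>

definition symbol_entropy :: "'a fuzzy_0L \<Rightarrow> 'a \<Rightarrow> real" where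
  "symbol_entropy FG a = - (\<Sum>r\<in>labels_of FG a. mu FG r * log 2 (mu FG r))"

lemma mu_labels_of:
  "r \<in> labels_of FG a \<Longrightarrow> mu FG r = grade FG r / (\<Sum>s\<in>labels_of FG a. grade FG s)"
  by (simp add: mu_def labels_of_def)

context
  fixes FG :: "'a fuzzy_0L"
  assumes FG: "is_fuzzy_0L FG"
begin

lemma finite_labels_of: "finite (labels_of FG a)"
proof -
  have "finite (SIGMA a:falphabet FG. fsubst FG a)"
    using FG by (auto simp: is_fuzzy_0L_def is_finite_subst_def)
  then have "finite (labels FG)"
    using FG bij_betw_finite by (auto simp: is_fuzzy_0L_def)
  then show ?thesis by (simp add: labels_of_def)
qed

lemma mu_nonneg: "r \<in> labels_of FG a \<Longrightarrow> mu FG r \<ge> 0"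
  using FG unfolding mu_labels_of
  by (auto simp: is_fuzzy_0L_def labels_of_def intro!: divide_nonneg_nonneg sum_nonneg)

lemma sum_mu: "a \<in> falphabet FG \<Longrightarrow> (\<Sum>r\<in>labels_of FG a. mu FG r) = 1"
  using FG by (simp add: mu_labels_of sum_divide_distrib[symmetric] is_fuzzy_0L_def)

lemma mu_le_1: "a \<in> falphabet FG \<Longrightarrow> r \<in> labels_of FG a \<Longrightarrow> mu FG r \<le> 1"
  using member_le_sum[of r "labels_of FG a" "mu FG"] sum_mu[of a] finite_labels_of mu_nonneg by auto

text \<open>For \<open>mu FG r = 0\<close> the product is 0 whatever \<open>log 2 0\<close> is;
  otherwise \<open>mu FG r\<close> lies in (0, 1] and its logarithm is not positive.\<close>

lemma entropy_term_nonpos: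
  "a \<in> falphabet FG \<Longrightarrow> r \<in> labels_of FG a \<Longrightarrow> mu FG r * log 2 (mu FG r) \<le> 0"
  using mu_le_1[of a r] mu_nonneg[of r a]
  by (cases "mu FG r = 0") (auto simp: mult_le_0_iff log_le_zero_cancel_iff)

lemma symbol_entropy_nonneg: "a \<in> falphabet FG \<Longrightarrow> symbol_entropy FG a \<ge> 0"
  using entropy_term_nonpos by (auto simp: symbol_entropy_def intro!: sum_nonpos)

text \<open>The summands share one sign, so the sum vanishes only if each does, and x log x = 0 with
  x \<ge> 0 forces x to be 0 or 1. As the values add up to 1, one production is certain.\<close>

lemma symbol_entropy_eq_0_iff:
  assumes a: "a \<in> falphabet FG"
  shows "symbol_entropy FG a = 0 \<longleftrightarrow> (\<forall>r\<in>labels_of FG a. mu FG r \<in> {0, 1})"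
proof -
  have "symbol_entropy FG a = (\<Sum>r\<in>labels_of FG a. - (mu FG r * log 2 (mu FG r)))"
    by (simp add: symbol_entropy_def sum_negf)
  then have "symbol_entropy FG a = 0 \<longleftrightarrow> (\<forall>r\<in>labels_of FG a. mu FG r * log 2 (mu FG r) = 0)"
    using entropy_term_nonpos[OF a] finite_labels_of by (simp add: sum_nonneg_eq_0_iff)
  also have "\<dots> \<longleftrightarrow> (\<forall>r\<in>labels_of FG a. mu FG r \<in> {0, 1})"
  proof (intro ball_cong refl)
    fix r assume "r \<in> labels_of FG a"
    then have "mu FG r \<ge> 0" by (rule mu_nonneg)
    then show "mu FG r * log 2 (mu FG r) = 0 \<longleftrightarrow> mu FG r \<in> {0, 1}"
      by (cases "mu FG r = 0") (auto simp: log_def)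
  qed
  finally show ?thesis .
qed

section \<open>Additivity of entropy over words\<close>

lemma label_words_Nil: "label_words FG [] = {[]}"
  by (auto simp: label_words_def)

lemma label_words_Cons:
  "label_words FG (a # w) = (\<lambda>(r, \<alpha>). r # \<alpha>) ` (labels_of FG a \<times> label_words FG w)"
  by (auto simp: label_words_def list_all2_Cons2)

lemma sum_label_words_Cons:
  "(\<Sum>\<alpha>\<in>label_words FG (a # w). f \<alpha>) = (\<Sum>r\<in>labels_of FG a. \<Sum>\<alpha>\<in>label_words FG w. f (r # \<alpha>))"
proof -
  have "inj_on (\<lambda>(r, \<alpha>). r # \<alpha>) (labels_of FG a \<times> label_words FG w)" by (auto simp: inj_on_def)
  then show ?thesis
    by (simp add: label_words_Cons sum.reindex sum.cartesian_product case_prod_unfold)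
qed

lemma mu_word_nonneg: "\<alpha> \<in> label_words FG w \<Longrightarrow> mu_word FG \<alpha> \<ge> 0"
  by (induction w arbitrary: \<alpha>)
    (auto simp: label_words_Nil label_words_Cons mu_word_def mu_nonneg)

lemma sum_mu_word: "w \<in> lists (falphabet FG) \<Longrightarrow> (\<Sum>\<alpha>\<in>label_words FG w. mu_word FG \<alpha>) = 1"
proof (induction w)
  case Nil
  show ?case by (simp add: label_words_Nil mu_word_def)
next
  case (Cons a w)
  have "(\<Sum>\<alpha>\<in>label_words FG (a # w). mu_word FG \<alpha>)
      = (\<Sum>r\<in>labels_of FG a. mu FG r * (\<Sum>\<alpha>\<in>label_words FG w. mu_word FG \<alpha>))"
    by (simp add: sum_label_words_Cons mu_word_def sum_distrib_left)
  then show ?case using Cons sum_mu by simp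
qed

text \<open>The labels of the letters are independent choices: \<open>mu_word\<close> is a product,
  the logarithm makes it a sum, and the factor summed out has total mass 1.\<close>

lemma fuzzy_entropy_eq_sum_list:
  "w \<in> lists (falphabet FG) \<Longrightarrow> fuzzy_entropy FG w = sum_list (map (symbol_entropy FG) w)"
proof -
  \<comment> \<open>Product rule for x log x, valid also when a factor is 0, since then both sides
    vanish.\<close>
  have mult_log: "x * y * log 2 (x * y) = y * (x * log 2 x) + x * (y * log 2 y)"
    if "x \<ge> 0" "y \<ge> 0" for x y :: real
    using that by (cases "x = 0 \<or> y = 0") (auto simp: log_mult algebra_simps)
  have "- (\<Sum>\<alpha>\<in>label_words FG w. mu_word FG \<alpha> * log 2 (mu_word FG \<alpha>))
      = sum_list (map (symbol_entropy FG) w)" if "w \<in> lists (falphabet FG)"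
    using that
  proof (induction w)
    case Nil
    show ?case by (simp add: label_words_Nil mu_word_def)
  next
    case (Cons a w)
    let ?H = "\<lambda>x. x * log 2 x"
    have "(\<Sum>\<alpha>\<in>label_words FG (a # w). ?H (mu_word FG \<alpha>))
        = (\<Sum>r\<in>labels_of FG a. \<Sum>\<alpha>\<in>label_words FG w.
             mu_word FG \<alpha> * ?H (mu FG r) + mu FG r * ?H (mu_word FG \<alpha>))"
      unfolding sum_label_words_Cons
    proof (intro sum.cong refl)
      fix r \<alpha> assume "r \<in> labels_of FG a" "\<alpha> \<in> label_words FG w"
      then show "?H (mu_word FG (r # \<alpha>)) = mu_word FG \<alpha> * ?H (mu FG r) + mu FG r * ?H (mu_word FG \<alpha>)"
        using mult_log[OF mu_nonneg mu_word_nonneg] by (simp add: mu_word_def)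
    qed
    also have "\<dots> = (\<Sum>\<alpha>\<in>label_words FG w. mu_word FG \<alpha>) * (\<Sum>r\<in>labels_of FG a. ?H (mu FG r))
        + (\<Sum>r\<in>labels_of FG a. mu FG r) * (\<Sum>\<alpha>\<in>label_words FG w. ?H (mu_word FG \<alpha>))"
      by (simp add: sum.distrib sum_distrib_left[symmetric] sum_distrib_right[symmetric])
    also have "\<dots> = (\<Sum>r\<in>labels_of FG a. ?H (mu FG r)) + (\<Sum>\<alpha>\<in>label_words FG w. ?H (mu_word FG \<alpha>))"
    proof -
      have "a \<in> falphabet FG" "w \<in> lists (falphabet FG)" using Cons.hyps by auto
      then show ?thesis by (simp only: sum_mu sum_mu_word mult_1)
    qed
    finally show ?case using Cons by (simp add: symbol_entropy_def)
  qed
  moreover assume "w \<in> lists (falphabet FG)"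
  ultimately show ?thesis by (auto simp: fuzzy_entropy_def)
qed

lemma generated_in_falphabet: "generated (fsubst FG) (faxiom FG) \<subseteq> lists (falphabet FG)"
  using FG by (intro generated_in_lists) (auto simp: is_fuzzy_0L_def is_finite_subst_def)

lemma bounded_entropy_lang_eq:
  "bounded_entropy_lang FG c =
     {w \<in> generated (fsubst FG) (faxiom FG). sum_list (map (symbol_entropy FG) w) \<le> c}"
proof -
  have "fuzzy_entropy FG w = sum_list (map (symbol_entropy FG) w)"
    if "w \<in> generated (fsubst FG) (faxiom FG)" for w
    using that generated_in_falphabet fuzzy_entropy_eq_sum_list by blast
  then show ?thesis by (auto simp: bounded_entropy_lang_def)
qed

text \<open>Nonnegative summands total at most 0 only if all are 0, so the bound 0 acts as a
  terminal alphabet.\<close>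

lemma bounded_entropy_lang_0:
  "bounded_entropy_lang FG 0 =
     generated (fsubst FG) (faxiom FG) \<inter> lists {a \<in> falphabet FG. symbol_entropy FG a = 0}"
proof -
  \<comment> \<open>Nonnegativity is carried through the induction: it lets a total \<le> 0 force
    both the head and the tail to be 0.\<close>
  have "sum_list (map (symbol_entropy FG) w) \<ge> 0 \<and> (sum_list (map (symbol_entropy FG) w) \<le> 0 \<longleftrightarrow>
      w \<in> lists {a \<in> falphabet FG. symbol_entropy FG a = 0})" if "w \<in> lists (falphabet FG)" for w
    using that by (induction w) (auto dest!: symbol_entropy_nonneg)
  then show ?thesis using generated_in_falphabet unfolding bounded_entropy_lang_eq by blast
qed

end

section \<open>The two inclusions\<close>

lemma class_BFEL_subset_class_E0L: "(class_BFEL :: 'a::infinite list set set) \<subseteq> class_E0L"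
proof
  fix L :: "'a list set" assume "L \<in> class_BFEL"
  then obtain FG c where FG: "is_fuzzy_0L FG" and L: "L = bounded_entropy_lang FG c"
    by (auto simp: class_BFEL_def)
  have "finite (falphabet FG)" "is_finite_subst (falphabet FG) (fsubst FG)"
      "faxiom FG \<in> lists (falphabet FG)"
    using FG unfolding is_fuzzy_0L_def by blast+
  then show "L \<in> class_E0L"
    unfolding L bounded_entropy_lang_eq[OF FG]
    by (rule weight_bounded_in_class_E0L) (rule symbol_entropy_nonneg[OF FG])
qed

text \<open>A symbol of \<open>\<Delta>\<close> puts grade 1 on one chosen production
  \<open>q a\<close> and 0 on the others, so its choice is certain; any other symbol gets grade 1
  throughout, hence a uniform choice. A uniform choice has positive entropy only among at least two
  productions.\<close>

lemma ex_fuzzy_0L_zero_entropy: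
  assumes fin: "finite \<Sigma>" and h: "is_finite_subst \<Sigma> h" and \<omega>: "\<omega> \<in> lists \<Sigma>"
    and two: "\<And>a. a \<in> \<Sigma> - \<Delta> \<Longrightarrow> card (h a) \<ge> 2"
  shows "\<exists>FG. is_fuzzy_0L FG \<and> falphabet FG = \<Sigma> \<and> fsubst FG = h \<and> faxiom FG = \<omega> \<and>
           {a \<in> \<Sigma>. symbol_entropy FG a = 0} = \<Sigma> \<inter> \<Delta>"
proof -
  let ?P = "SIGMA a:\<Sigma>. h a"
  have h': "finite (h a)" "h a \<noteq> {}" if "a \<in> \<Sigma>" for a
    using that h by (auto simp: is_finite_subst_def)
  have "finite ?P" using fin h' by auto
  then obtain p where p: "bij_betw p {0..<card ?P} ?P" using ex_bij_betw_nat_finite by blast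
  define J where "J = {0..<card ?P}"
  define q where "q a = (SOME r. r \<in> J \<and> fst (p r) = a)" for a
  define FG where "FG = \<lparr>falphabet = \<Sigma>, fsubst = h, faxiom = \<omega>, labels = J, production = p,
      grade = (\<lambda>r. if fst (p r) \<in> \<Delta> \<and> r \<noteq> q (fst (p r)) then 0 else 1)\<rparr>"
  have p: "bij_betw p J ?P" using p by (simp add: J_def)
  have la: "labels_of FG a = {r \<in> J. fst (p r) = a}" for a by (simp add: labels_of_def FG_def)
  have finla: "finite (labels_of FG a)" for a unfolding la by (simp add: J_def)
  \<comment> \<open>Labels of \<open>a\<close> match its right-hand sides one to one, which turns
    the total grade outside \<open>\<Delta>\<close> into \<open>card (h a)\<close>.\<close>
  have cardla: "card (labels_of FG a) = card (h a)" if "a \<in> \<Sigma>" for a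
  proof -
    have "bij_betw p (labels_of FG a) ({a} \<times> h a)"
      unfolding bij_betw_def
    proof
      show "inj_on p (labels_of FG a)"
        by (rule inj_on_subset[OF bij_betw_imp_inj_on[OF p]]) (auto simp: la)
      show "p ` labels_of FG a = {a} \<times> h a"
      proof (intro equalityI subsetI)
        fix x assume "x \<in> p ` labels_of FG a"
        then obtain r where "r \<in> J" "fst (p r) = a" "x = p r" by (auto simp: la)
        then show "x \<in> {a} \<times> h a" using bij_betwE[OF p] by (cases "p r") auto
      next
        fix x assume x: "x \<in> {a} \<times> h a"
        then have "x \<in> ?P" using \<open>a \<in> \<Sigma>\<close> by auto
        then obtain r where "r \<in> J" "x = p r" using p by (auto simp: bij_betw_def)
        then show "x \<in> p ` labels_of FG a" using x by (auto simp: la)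
      qed
    qed
    then show ?thesis by (simp add: bij_betw_same_card card_cartesian_product_singleton)
  qed
  have q: "q a \<in> labels_of FG a" if "a \<in> \<Sigma>" for a
  proof -
    have "card (h a) \<noteq> 0" using h'[OF that] by simp
    then have "labels_of FG a \<noteq> {}" using cardla[OF that] by auto
    then have "\<exists>r. r \<in> J \<and> fst (p r) = a" by (auto simp: la)
    then show ?thesis unfolding la q_def by (metis (mono_tags, lifting) mem_Collect_eq someI_ex)
  qed
  have gr: "grade FG r = (if a \<in> \<Delta> \<and> r \<noteq> q a then 0 else 1)" if "r \<in> labels_of FG a" for r a
    using that by (auto simp: la) (auto simp: FG_def)
  have tot: "(\<Sum>r\<in>labels_of FG a. grade FG r) = (if a \<in> \<Delta> then 1 else real (card (h a)))"
    if "a \<in> \<Sigma>" for a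
  proof (cases "a \<in> \<Delta>")
    case True
    then have "(\<Sum>r\<in>labels_of FG a. grade FG r) = (\<Sum>r\<in>labels_of FG a. if r = q a then 1 else 0)"
      by (intro sum.cong) (auto simp: gr)
    then show ?thesis using True q[OF that] finla by simp
  next
    case False
    then show ?thesis using cardla[OF that] by (simp add: gr)
  qed
  have "(\<Sum>r\<in>labels_of FG a. grade FG r) \<noteq> 0" if "a \<in> \<Sigma>" for a
    using h'[OF that] by (simp add: tot[OF that])
  then have FG: "is_fuzzy_0L FG"
    using fin h \<omega> p unfolding is_fuzzy_0L_def by (simp add: FG_def)
  have "symbol_entropy FG a = 0 \<longleftrightarrow> a \<in> \<Delta>" if a: "a \<in> \<Sigma>" for a
  proof (cases "a \<in> \<Delta>")
    case True
    then have "mu FG r \<in> {0, 1}" if "r \<in> labels_of FG a" for r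
      using that by (simp add: mu_labels_of tot[OF a]) (simp add: gr)
    then show ?thesis using True symbol_entropy_eq_0_iff[OF FG, of a] a by (simp add: FG_def)
  next
    case False
    \<comment> \<open>Here \<open>mu FG (q a)\<close> is \<open>1 / card (h a)\<close>, strictly
      between 0 and 1.\<close>
    have "card (h a) \<ge> 2" using two a False by simp
    then have "mu FG (q a) \<notin> {0, 1}"
      using False by (simp add: mu_labels_of[OF q[OF a]] tot[OF a] gr[OF q[OF a]])
    then show ?thesis
      using False q[OF a] symbol_entropy_eq_0_iff[OF FG, of a] a by (auto simp: FG_def)
  qed
  then show ?thesis using FG by (intro exI[of _ FG]) (auto simp: FG_def)
qed

text \<open>A nonterminal with a single production would have entropy 0 under any grading. The
  production into the dead symbol excludes this, and the words it adds are discarded because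
  \<open>d\<close> is not terminal.\<close>

lemma class_E0L_subset_class_BFEL: "(class_E0L :: 'a::infinite list set set) \<subseteq> class_BFEL"
proof
  fix L :: "'a list set" assume "L \<in> class_E0L"
  then obtain G where G: "is_E0L G" and L: "L = E0L_lang G" by (auto simp: class_E0L_def)
  define \<Sigma> where "\<Sigma> = alphabet G"
  define h where "h = subst G"
  have fin: "finite \<Sigma>" and h: "\<And>a. a \<in> \<Sigma> \<Longrightarrow> finite (h a) \<and> h a \<noteq> {} \<and> h a \<subseteq> lists \<Sigma>"
    and \<omega>: "axiom_word G \<in> lists \<Sigma>" and \<Delta>: "terminals G \<subseteq> \<Sigma>"
    using G by (auto simp: is_E0L_def is_finite_subst_def \<Sigma>_def h_def)
  obtain d where d: "d \<notin> \<Sigma>" using fin ex_new_if_finite infinite_UNIV by blast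
  \<comment> \<open>\<open>d\<close> is itself a nonterminal, so it needs two productions as well;
    both keep the word outside \<open>lists \<Sigma>\<close>.\<close>
  define h' where "h' a = (if a \<in> \<Sigma> then insert [d] (h a) else {[d], [d, d]})" for a
  have h'l: "h' a \<subseteq> lists (insert d \<Sigma>)" for a
    using h[of a] lists_mono[of \<Sigma> "insert d \<Sigma>"] by (auto simp: h'_def)
  have h'fs: "is_finite_subst (insert d \<Sigma>) h'"
    using h h'l by (auto simp: is_finite_subst_def h'_def)
  have two: "card (h' a) \<ge> 2" for a
  proof (cases "a \<in> \<Sigma>")
    case True
    \<comment> \<open>The words of \<open>h a\<close> avoid \<open>d\<close>, so \<open>[d]\<close>
      is a genuinely new right-hand side.\<close>
    then have "[d] \<notin> h a" "finite (h a)" "card (h a) > 0" using h[of a] d by (auto simp: card_gt_0_iff)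
    then show ?thesis using True by (simp add: h'_def Suc_le_eq)
  qed (simp add: h'_def)
  have "axiom_word G \<in> lists (insert d \<Sigma>)" using \<omega> by auto
  then obtain FG where FG: "is_fuzzy_0L FG" "falphabet FG = insert d \<Sigma>" "fsubst FG = h'"
      "faxiom FG = axiom_word G"
      "{a \<in> insert d \<Sigma>. symbol_entropy FG a = 0} = insert d \<Sigma> \<inter> terminals G"
    using ex_fuzzy_0L_zero_entropy[of "insert d \<Sigma>" h' "axiom_word G" "terminals G"] fin h'fs two
    by auto
  have "insert d \<Sigma> \<inter> terminals G = terminals G" using \<Delta> by auto
  then have "bounded_entropy_lang FG 0 = generated h' (axiom_word G) \<inter> lists (terminals G)"
    using bounded_entropy_lang_0[OF FG(1)] FG by simp
  \<comment> \<open>Terminal words lie over \<open>\<Sigma>\<close>, where \<open>h'\<close> and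
    \<open>h\<close> derive the same words.\<close>
  also have "\<dots> = generated h' (axiom_word G) \<inter> lists \<Sigma> \<inter> lists (terminals G)"
    using lists_mono[OF \<Delta>] by auto
  also have "generated h' (axiom_word G) \<inter> lists \<Sigma> = generated h (axiom_word G)"
  proof (rule generated_Int_lists[where \<Sigma> = "insert d \<Sigma>"])
    show "h' a \<inter> lists \<Sigma> = h a" if "a \<in> \<Sigma>" for a using that h d by (fastforce simp: h'_def)
    show "h' a \<inter> lists \<Sigma> = {}" if "a \<in> insert d \<Sigma> - \<Sigma>" for a using that d by (auto simp: h'_def)
  qed (use h'l \<omega> in auto)
  also have "\<dots> \<inter> lists (terminals G) = L" by (simp add: L E0L_lang_def h_def)
  finally show "L \<in> class_BFEL" unfolding class_BFEL_def using FG(1) by force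
qed

theorem theorem4: "(class_BFEL :: 'a::infinite list set set) = class_E0L"
  using class_BFEL_subset_class_E0L class_E0L_subset_class_BFEL by (rule equalityI)

end
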